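(* Let $\sigma\in(0,1)$, let $E_1,E_2\subseteq\mathbb R^n$ and $F:=(E_1\cap B_1)\cup(E_2\setminus B_1)$. Then $$F\cap B_1=E_1\cap B_1\quad\text{and}\quad F\setminus B_1=E_2\setminus B_1,$$ and $$\mathrm{Per}_\sigma(F,B_{3/2})-\mathrm{Per}_\sigma(E_2,B_{3/2})\le\mathrm{Per}_\sigma(E_1,B_1)-\mathrm{Per}_\sigma(E_2,B_1)+\mathcal L\big(B_1,(E_1\Delta E_2)\setminus B_1\big).$$
   Context: $B_r=\{x\in\mathbb R^n:|x|<r\}$; $A^c=\mathbb R^n\setminus A$; $E_1\Delta E_2$ is the symmetric difference. Sets are understood to be measurable. For disjoint measurable $A,B\subseteq\mathbb R^n$, $\mathcal L(A,B)=\iint_{A\times B}\frac{dx\,dy}{|x-y|^{n+\sigma}}$, and for a bounded Lipschitz domain $\Omega\subset\mathbb R^n$ and a set $E\subseteq\mathbb R^n$ the $\sigma$-fractional perimeter of $E$ in $\Omega$ is $$\mathrm{Per}_\sigma(E,\Omega)=\mathcal L(E\cap\Omega,E^c\cap\Omega)+\mathcal L(E\cap\Omega,E^c\cap\Omega^c)+\mathcal L(E\cap\Omega^c,E^c\cap\Omega).$$ *)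

theory Defs
  imports "HOL-Analysis.Analysis"
begin

text \<open>
  The interaction and the perimeter may be infinite, so they take values in
  \<open>ennreal\<close>. The interaction is only meant for disjoint measurable \<open>A\<close> and \<open>B\<close>, so the
  convention \<open>1 / 0 = 0\<close> on the diagonal plays no role.
\<close>

definition interaction :: "real \<Rightarrow> (real^'n) set \<Rightarrow> (real^'n) set \<Rightarrow> ennreal" where
  "interaction \<sigma> A B =
     (\<integral>\<^sup>+ (x, y) \<in> A \<times> B.
        ennreal (1 / norm (x - y) powr (real CARD('n) + \<sigma>)) \<partial>(lebesgue \<Otimes>\<^sub>M lebesgue))"

definition fractional_perimeter :: "real \<Rightarrow> (real^'n) set \<Rightarrow> (real^'n) set \<Rightarrow> ennreal" where
  "fractional_perimeter \<sigma> E \<Omega> =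
     interaction \<sigma> (E \<inter> \<Omega>) (- E \<inter> \<Omega>)
     + interaction \<sigma> (E \<inter> \<Omega>) (- E \<inter> - \<Omega>)
     + interaction \<sigma> (E \<inter> - \<Omega>) (- E \<inter> \<Omega>)"

end

theory Submission
  imports Defs
begin

text \<open>
  For measurable \<open>\<Omega>\<close>, \<open>Per(E, \<Omega>)\<close> is the integral of the kernel over the pairs \<open>(x, y)\<close> with
  \<open>x \<in> E\<close>, \<open>y \<notin> E\<close> and not both points outside \<open>\<Omega>\<close>, so the inequality reduces to comparing
  indicator functions of pairs. Writing \<open>B\<close> for the unit ball, pairs with both points in \<open>B\<close> or
  both outside contribute equally to the two sides. For \<open>x \<in> B\<close> and \<open>y \<notin> B\<close> the excess lies in
  \<open>(B \<inter> E1) \<times> (E1 - E2 - B)\<close>, and for \<open>x \<notin> B\<close> and \<open>y \<in> B\<close> in \<open>(E2 - E1 - B) \<times> (B - E1)\<close>. After swapping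
  the second product, the two are disjoint parts of \<open>B \<times> (sym_diff E1 E2 - B)\<close>.
\<close>

text \<open>Used to swap coordinates in the product measure. A countable Borel cover by sets of
  finite \<open>lborel\<close> measure serves again, since \<open>lebesgue\<close> agrees with
  \<open>lborel\<close> on Borel sets.\<close>

lemma sigma_finite_measure_lebesgue:
  "sigma_finite_measure (lebesgue :: 'a::euclidean_space measure)"
proof
  obtain A :: "'a set set" where "countable A" "A \<subseteq> sets lborel" "\<Union>A = space lborel"
    "\<forall>a\<in>A. emeasure lborel a \<noteq> \<infinity>"
    using lborel.sigma_finite_countable by blast
  then show "\<exists>A::'a set set. countable A \<and> A \<subseteq> sets lebesgue \<and> \<Union>A = space lebesgue
      \<and> (\<forall>a\<in>A. emeasure lebesgue a \<noteq> \<infinity>)"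
    by (intro exI[of _ A]) (auto simp: subset_iff)
qed

lemma Compl_in_sets_lebesgue_measurable [measurable (raw)]:
  "A \<in> sets lebesgue \<Longrightarrow> - A \<in> sets lebesgue"
  using sets.compl_sets[of A lebesgue] by (simp add: Compl_eq_Diff_UNIV)

text \<open>A single pair argument lets the kernel be integrated over sets of pairs that are not
  rectangles.\<close>

definition interaction_kernel :: "real \<Rightarrow> (real^'n) \<times> (real^'n) \<Rightarrow> ennreal" where
  "interaction_kernel \<sigma> p = ennreal (1 / norm (fst p - snd p) powr (real CARD('n) + \<sigma>))"

lemma measurable_interaction_kernel [measurable]:
  "interaction_kernel \<sigma> \<in> borel_measurable
     (lebesgue \<Otimes>\<^sub>M (lebesgue :: (real^'n) measure))"
proof -
  \<comment> \<open>Each projection is measurable into \<open>lebesgue\<close>, hence into the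
    coarser Borel sigma-algebra.\<close>
  have "fst \<in> borel_measurable (lebesgue \<Otimes>\<^sub>M (lebesgue :: (real^'n) measure))"
    "snd \<in> borel_measurable ((lebesgue :: (real^'n) measure) \<Otimes>\<^sub>M lebesgue)"
    by (auto intro!: measurable_compose[OF measurable_fst] measurable_compose[OF measurable_snd]
        measurable_completion)
  then show ?thesis
    unfolding interaction_kernel_def by measurable
qed

lemma interaction_eq_nn_integral:
  "interaction \<sigma> A B =
     (\<integral>\<^sup>+ p. interaction_kernel \<sigma> p * indicator (A \<times> B) p \<partial>(lebesgue \<Otimes>\<^sub>M lebesgue))"
  unfolding interaction_def interaction_kernel_def by (simp add: case_prod_beta)

text \<open>The kernel is symmetric and swapping coordinates preserves the product measure.\<close>

lemma interaction_commute:
  assumes [measurable]: "A \<in> sets lebesgue" "B \<in> sets lebesgue"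
  shows "interaction \<sigma> A B = interaction \<sigma> B A"
proof -
  interpret pair_sigma_finite "lebesgue :: (real^'n) measure" "lebesgue :: (real^'n) measure"
    by (intro pair_sigma_finite.intro sigma_finite_measure_lebesgue)
  have "interaction \<sigma> A B = (\<integral>\<^sup>+ p. interaction_kernel \<sigma> p * indicator (A \<times> B) p
      \<partial>distr (lebesgue \<Otimes>\<^sub>M lebesgue) (lebesgue \<Otimes>\<^sub>M lebesgue) (\<lambda>(x, y). (y, x)))"
    unfolding interaction_eq_nn_integral by (subst distr_pair_swap) simp
  also have "\<dots> = interaction \<sigma> B A"
    unfolding interaction_eq_nn_integral
    by (subst nn_integral_distr, measurable)
      (auto intro!: nn_integral_cong
        simp: interaction_kernel_def norm_minus_commute indicator_def)
  finally show ?thesis .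
qed

lemma fractional_perimeter_eq_nn_integral:
  assumes [measurable]: "E \<in> sets lebesgue" "\<Omega> \<in> sets lebesgue"
  shows "fractional_perimeter \<sigma> E \<Omega> =
    (\<integral>\<^sup>+ p. interaction_kernel \<sigma> p * indicator (E \<times> - E - (- \<Omega>) \<times> (- \<Omega>)) p
       \<partial>(lebesgue \<Otimes>\<^sub>M lebesgue))"
proof -
  have "fractional_perimeter \<sigma> E \<Omega> = (\<integral>\<^sup>+ p.
        interaction_kernel \<sigma> p * indicator ((E \<inter> \<Omega>) \<times> (- E \<inter> \<Omega>)) p
      + interaction_kernel \<sigma> p * indicator ((E \<inter> \<Omega>) \<times> (- E \<inter> - \<Omega>)) p
      + interaction_kernel \<sigma> p * indicator ((E \<inter> - \<Omega>) \<times> (- E \<inter> \<Omega>)) p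
      \<partial>(lebesgue \<Otimes>\<^sub>M lebesgue))"
    unfolding fractional_perimeter_def interaction_eq_nn_integral
    by (simp add: nn_integral_add)
  also have "\<dots> = (\<integral>\<^sup>+ p. interaction_kernel \<sigma> p * indicator (E \<times> - E - (- \<Omega>) \<times> (- \<Omega>)) p
      \<partial>(lebesgue \<Otimes>\<^sub>M lebesgue))"
    \<comment> \<open>The three rectangles partition the set of pairs on the right.\<close>
    by (rule nn_integral_cong) (auto simp: indicator_def)
  finally show ?thesis .
qed

lemma interaction_add_le:
  assumes [measurable]: "A1 \<in> sets lebesgue" "A2 \<in> sets lebesgue"
    "B1 \<in> sets lebesgue" "B2 \<in> sets lebesgue"
    and "A1 \<times> B1 \<inter> A2 \<times> B2 = {}" "A1 \<times> B1 \<union> A2 \<times> B2 \<subseteq> A \<times> B"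
  shows "interaction \<sigma> A1 B1 + interaction \<sigma> A2 B2 \<le> interaction \<sigma> A B"
proof -
  have "interaction \<sigma> A1 B1 + interaction \<sigma> A2 B2 = (\<integral>\<^sup>+ p.
        interaction_kernel \<sigma> p * indicator (A1 \<times> B1) p
      + interaction_kernel \<sigma> p * indicator (A2 \<times> B2) p \<partial>(lebesgue \<Otimes>\<^sub>M lebesgue))"
    unfolding interaction_eq_nn_integral by (simp add: nn_integral_add)
  also have "\<dots> \<le> interaction \<sigma> A B"
    unfolding interaction_eq_nn_integral
    using assms(5,6) by (intro nn_integral_mono) (auto simp: indicator_def)
  finally show ?thesis .
qed

lemma fractional_perimeter_glue_le:
  fixes E1 E2 B \<Omega> :: "(real^'n) set"
  assumes [measurable]: "E1 \<in> sets lebesgue" "E2 \<in> sets lebesgue"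
    "B \<in> sets lebesgue" "\<Omega> \<in> sets lebesgue"
    and "B \<subseteq> \<Omega>"
  shows "fractional_perimeter \<sigma> (E1 \<inter> B \<union> (E2 - B)) \<Omega> + fractional_perimeter \<sigma> E2 B
    \<le> fractional_perimeter \<sigma> E1 B + interaction \<sigma> B (sym_diff E1 E2 - B)
       + fractional_perimeter \<sigma> E2 \<Omega>"
proof -
  let ?F = "E1 \<inter> B \<union> (E2 - B)"
  let ?P = "\<lambda>E \<Omega>. E \<times> - E - (- \<Omega>) \<times> (- \<Omega>) :: ((real^'n) \<times> (real^'n)) set"
  let ?k = "interaction_kernel \<sigma> :: (real^'n) \<times> (real^'n) \<Rightarrow> ennreal"
  \<comment> \<open>As \<open>B\<close> lies in \<open>\<Omega>\<close>, a pair meeting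
    \<open>B\<close> is counted relative to both sets, so its two \<open>E2\<close> terms agree. A
    pair missing \<open>B\<close> contributes nothing relative to \<open>B\<close>, and
    \<open>?F\<close> agrees with \<open>E2\<close> on it.\<close>
  have pointwise: "?k p * indicator (?P ?F \<Omega>) p + ?k p * indicator (?P E2 B) p
      \<le> ?k p * indicator (?P E1 B) p + ?k p * indicator (?P E2 \<Omega>) p
        + (?k p * indicator ((B \<inter> E1) \<times> (E1 - E2 - B)) p
        + ?k p * indicator ((E2 - E1 - B) \<times> (B - E1)) p)" for p
    using \<open>B \<subseteq> \<Omega>\<close> by (cases p) (auto simp: indicator_def)
  have "fractional_perimeter \<sigma> ?F \<Omega> + fractional_perimeter \<sigma> E2 B
      = (\<integral>\<^sup>+ p. ?k p * indicator (?P ?F \<Omega>) p + ?k p * indicator (?P E2 B) p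
          \<partial>(lebesgue \<Otimes>\<^sub>M lebesgue))"
    by (simp add: fractional_perimeter_eq_nn_integral nn_integral_add)
  also have "\<dots> \<le> (\<integral>\<^sup>+ p. ?k p * indicator (?P E1 B) p + ?k p * indicator (?P E2 \<Omega>) p
        + (?k p * indicator ((B \<inter> E1) \<times> (E1 - E2 - B)) p
        + ?k p * indicator ((E2 - E1 - B) \<times> (B - E1)) p) \<partial>(lebesgue \<Otimes>\<^sub>M lebesgue))"
    by (intro nn_integral_mono pointwise)
  also have "\<dots> = fractional_perimeter \<sigma> E1 B + fractional_perimeter \<sigma> E2 \<Omega>
      + (interaction \<sigma> (B \<inter> E1) (E1 - E2 - B) + interaction \<sigma> (E2 - E1 - B) (B - E1))"
    by (simp add: fractional_perimeter_eq_nn_integral interaction_eq_nn_integral nn_integral_add)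
  \<comment> \<open>After the swap the first factors \<open>B \<inter> E1\<close> and
    \<open>B - E1\<close> are disjoint parts of \<open>B\<close>, as
    \<open>interaction_add_le\<close> requires.\<close>
  also have "interaction \<sigma> (E2 - E1 - B) (B - E1) = interaction \<sigma> (B - E1) (E2 - E1 - B)"
    by (rule interaction_commute) measurable
  also have "interaction \<sigma> (B \<inter> E1) (E1 - E2 - B) + \<dots> \<le> interaction \<sigma> B (sym_diff E1 E2 - B)"
    by (rule interaction_add_le) auto
  finally show ?thesis
    by (simp add: add_ac add_left_mono)
qed

text \<open>
  If \<open>d = \<infinity>\<close> and \<open>b\<close> is finite, then \<open>l = \<infinity>\<close>, and the right-hand side is \<open>- \<infinity> + \<infinity>\<close>, which is \<open>\<infinity>\<close> in
  \<open>ereal\<close>.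
\<close>
lemma enn2ereal_diff_le_diff_add:
  fixes a b c d l :: ennreal
  assumes "a + d \<le> c + l + b"
    and "\<not> (a = \<infinity> \<and> b = \<infinity>)" "\<not> (c = \<infinity> \<and> d = \<infinity>)"
  shows "enn2ereal a - enn2ereal b \<le> enn2ereal c - enn2ereal d + enn2ereal l"
  using assms
  by (cases a; cases b; cases c; cases d; cases l)
    (auto simp: top_unique simp flip: ennreal_plus)

(* Perimeters may be infinite. The inequality between differences is stated in the extended
   reals whenever neither difference is of the form infinity - infinity; the last conjunct is
   the same inequality with the subtracted terms moved across, which always makes sense. *)
theorem lemma6p3:
  fixes \<sigma> :: real and E1 E2 F :: "(real^'n) set"
  assumes "0 < \<sigma>" and "\<sigma> < 1"
    and "E1 \<in> sets lebesgue" and "E2 \<in> sets lebesgue"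
    and "F = (E1 \<inter> ball 0 1) \<union> (E2 - ball 0 1)"
  shows "F \<inter> ball 0 1 = E1 \<inter> ball 0 1 \<and> F - ball 0 1 = E2 - ball 0 1
    \<and> (\<not> (fractional_perimeter \<sigma> F (ball 0 (3/2)) = \<infinity>
          \<and> fractional_perimeter \<sigma> E2 (ball 0 (3/2)) = \<infinity>)
       \<and> \<not> (fractional_perimeter \<sigma> E1 (ball 0 1) = \<infinity>
          \<and> fractional_perimeter \<sigma> E2 (ball 0 1) = \<infinity>)
       \<longrightarrow> enn2ereal (fractional_perimeter \<sigma> F (ball 0 (3/2)))
             - enn2ereal (fractional_perimeter \<sigma> E2 (ball 0 (3/2)))
           \<le> enn2ereal (fractional_perimeter \<sigma> E1 (ball 0 1))
             - enn2ereal (fractional_perimeter \<sigma> E2 (ball 0 1))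
             + enn2ereal (interaction \<sigma> (ball 0 1) (sym_diff E1 E2 - ball 0 1)))
    \<and> fractional_perimeter \<sigma> F (ball 0 (3/2)) + fractional_perimeter \<sigma> E2 (ball 0 1)
       \<le> fractional_perimeter \<sigma> E1 (ball 0 1)
         + interaction \<sigma> (ball 0 1) (sym_diff E1 E2 - ball 0 1)
         + fractional_perimeter \<sigma> E2 (ball 0 (3/2))"
proof -
  let ?B = "ball 0 1 :: (real^'n) set" and ?\<Omega> = "ball 0 (3/2) :: (real^'n) set"
  have le: "fractional_perimeter \<sigma> F ?\<Omega> + fractional_perimeter \<sigma> E2 ?B
      \<le> fractional_perimeter \<sigma> E1 ?B + interaction \<sigma> ?B (sym_diff E1 E2 - ?B)
        + fractional_perimeter \<sigma> E2 ?\<Omega>"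
    unfolding \<open>F = _\<close> using assms(3,4)
    \<comment> \<open>The inclusion of the balls comes from 1 \<le> 3/2.\<close>
    by (intro fractional_perimeter_glue_le subset_ball) auto
  show ?thesis
    using le enn2ereal_diff_le_diff_add[OF le] \<open>F = _\<close> by blast
qed

end
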